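(* For fixed nonnegative integers $p,q$, the set of forbidden induced subgraphs for the class of $(p,q)$-edge-split graphs is finite.
   Context: All graphs are simple, finite and undirected. A forbidden induced subgraph for a hereditary class (a class closed under taking induced subgraphs) is a graph not in the class all of whose proper induced subgraphs are in the class. A graph $G$ is a $(p,q)$-edge-split graph if $V(G)$ can be partitioned into sets $V_1$ and $V_2$ such that $G[V_1]$ can be obtained from a complete graph by deleting at most $p$ edges and $G[V_2]$ has at most $q$ edges. *)

theory Defs
  imports "HOL-Library.Ramsey"
begin

datatype 'a ugraph = UGraph (verts: "'a set") (edges: "'a set set")

definition simple_graph :: "'a ugraph \<Rightarrow> bool" where
  "simple_graph G \<longleftrightarrow> finite (verts G) \<and> edges G \<subseteq> [verts G]\<^bsup>2\<^esup>"

definition complete_graph :: "'a set \<Rightarrow> 'a ugraph" where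
  "complete_graph V = UGraph V ([V]\<^bsup>2\<^esup>)"

definition delete_edges :: "'a ugraph \<Rightarrow> 'a set set \<Rightarrow> 'a ugraph" where
  "delete_edges G F = UGraph (verts G) (edges G - F)"

definition induce :: "'a ugraph \<Rightarrow> 'a set \<Rightarrow> 'a ugraph" where
  "induce G S = UGraph S {e \<in> edges G. e \<subseteq> S}"

definition induced_subgraph :: "'a ugraph \<Rightarrow> 'a ugraph \<Rightarrow> bool" where
  "induced_subgraph H G \<longleftrightarrow> (\<exists>S \<subseteq> verts G. H = induce G S)"

definition proper_induced_subgraph :: "'a ugraph \<Rightarrow> 'a ugraph \<Rightarrow> bool" where
  "proper_induced_subgraph H G \<longleftrightarrow> (\<exists>S \<subset> verts G. H = induce G S)"

definition hereditary :: "'a ugraph set \<Rightarrow> bool" where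
  "hereditary C \<longleftrightarrow> (\<forall>G \<in> C. \<forall>H. induced_subgraph H G \<longrightarrow> H \<in> C)"

definition forbidden_induced_subgraphs :: "'a ugraph set \<Rightarrow> 'a ugraph set" where
  "forbidden_induced_subgraphs C =
     {G. simple_graph G \<and> G \<notin> C \<and> (\<forall>H. proper_induced_subgraph H G \<longrightarrow> H \<in> C)}"

text \<open>The two parts are allowed to be empty, as is usual for split graphs; otherwise the
  class would not be hereditary.\<close>

definition edge_split_graphs :: "nat \<Rightarrow> nat \<Rightarrow> 'a ugraph set" where
  "edge_split_graphs p q =
     {G. simple_graph G \<and>
         (\<exists>V1 V2. V1 \<union> V2 = verts G \<and> V1 \<inter> V2 = {} \<and>
            (\<exists>F. F \<subseteq> edges (complete_graph V1) \<and> card F \<le> p \<and>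
                 induce G V1 = delete_edges (complete_graph V1) F) \<and>
            card (edges (induce G V2)) \<le> q)}"

definition graph_iso :: "('a ugraph \<times> 'a ugraph) set" where
  "graph_iso =
     {(G, H). simple_graph G \<and> simple_graph H \<and>
        (\<exists>f. bij_betw f (verts G) (verts H) \<and>
             (\<forall>u \<in> verts G. \<forall>v \<in> verts G. {u, v} \<in> edges G \<longleftrightarrow> {f u, f v} \<in> edges H))}"

lemma equiv_graph_iso: "equiv {G. simple_graph G} (graph_iso :: ('a ugraph \<times> 'a ugraph) set)"
proof (rule equivI)
  show "(graph_iso :: ('a ugraph \<times> 'a ugraph) set) \<subseteq> {G. simple_graph G} \<times> {G. simple_graph G}"
    by (auto simp: graph_iso_def)
  show "refl_on {G. simple_graph G} (graph_iso :: ('a ugraph \<times> 'a ugraph) set)"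
    by (auto simp: refl_on_def graph_iso_def intro!: exI[of _ id])
  show "sym (graph_iso :: ('a ugraph \<times> 'a ugraph) set)"
  proof (rule symI)
    fix G H :: "'a ugraph"
    assume "(G, H) \<in> graph_iso"
    then obtain f where s: "simple_graph G" "simple_graph H"
      and f: "bij_betw f (verts G) (verts H)"
      and e: "\<And>u v. u \<in> verts G \<Longrightarrow> v \<in> verts G \<Longrightarrow>
                {u, v} \<in> edges G \<longleftrightarrow> {f u, f v} \<in> edges H"
      by (auto simp: graph_iso_def)
    let ?g = "inv_into (verts G) f"
    have g: "bij_betw ?g (verts H) (verts G)"
      using f by (rule bij_betw_inv_into)
    have "{u, v} \<in> edges H \<longleftrightarrow> {?g u, ?g v} \<in> edges G"
      if "u \<in> verts H" "v \<in> verts H" for u v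
      using e[of "?g u" "?g v"] that bij_betw_apply[OF g] bij_betw_inv_into_right[OF f] by auto
    with s g show "(H, G) \<in> graph_iso"
      by (auto simp: graph_iso_def)
  qed
  show "trans (graph_iso :: ('a ugraph \<times> 'a ugraph) set)"
  proof (rule transI)
    fix G H K :: "'a ugraph"
    assume "(G, H) \<in> graph_iso" "(H, K) \<in> graph_iso"
    then obtain f g where s: "simple_graph G" "simple_graph K"
      and f: "bij_betw f (verts G) (verts H)" and g: "bij_betw g (verts H) (verts K)"
      and e: "\<forall>u \<in> verts G. \<forall>v \<in> verts G. {u, v} \<in> edges G \<longleftrightarrow> {f u, f v} \<in> edges H"
        "\<forall>u \<in> verts H. \<forall>v \<in> verts H. {u, v} \<in> edges H \<longleftrightarrow> {g u, g v} \<in> edges K"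
      by (auto simp: graph_iso_def)
    have "bij_betw (g \<circ> f) (verts G) (verts K)"
      using f g by (rule bij_betw_trans)
    moreover have "\<forall>u \<in> verts G. \<forall>v \<in> verts G.
        {u, v} \<in> edges G \<longleftrightarrow> {(g \<circ> f) u, (g \<circ> f) v} \<in> edges K"
      using e bij_betw_apply[OF f] by simp
    ultimately show "(G, K) \<in> graph_iso"
      using s unfolding graph_iso_def by blast
  qed
qed

lemma hereditary_edge_split_graphs: "hereditary (edge_split_graphs p q :: 'a ugraph set)"
  unfolding hereditary_def
proof (intro ballI allI impI)
  fix G H :: "'a ugraph"
  assume G: "G \<in> edge_split_graphs p q" and "induced_subgraph H G"
  then obtain S where S: "S \<subseteq> verts G" and H: "H = induce G S"
    by (auto simp: induced_subgraph_def)
  from G obtain V1 V2 F where simp: "simple_graph G"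
    and V: "V1 \<union> V2 = verts G" "V1 \<inter> V2 = {}"
    and F: "F \<subseteq> [V1]\<^bsup>2\<^esup>" "card F \<le> p" "{e \<in> edges G. e \<subseteq> V1} = [V1]\<^bsup>2\<^esup> - F"
    and q: "card {e \<in> edges G. e \<subseteq> V2} \<le> q"
    by (auto simp: edge_split_graphs_def complete_graph_def delete_edges_def induce_def)
  have fin: "finite (verts G)" "finite (edges G)"
    using simp by (auto simp: simple_graph_def intro: finite_subset finite_imp_finite_nsets)
  have "finite V1" using fin(1) V(1) by (auto intro: finite_subset)
  then have "finite F"
    using F(1) finite_subset finite_imp_finite_nsets by blast
  have sH: "simple_graph H"
    using simp S unfolding simple_graph_def H induce_def
    by (auto simp: nsets_def intro: finite_subset)
  let ?F = "F \<inter> [V1 \<inter> S]\<^bsup>2\<^esup>"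
  have "card ?F \<le> p"
    using F(2) card_mono[OF \<open>finite F\<close>, of ?F] by auto
  moreover have "induce H (V1 \<inter> S) = delete_edges (complete_graph (V1 \<inter> S)) ?F"
    using F(3) by (auto simp: H induce_def delete_edges_def complete_graph_def nsets_def set_eq_iff)
  moreover have "card (edges (induce H (V2 \<inter> S))) \<le> q"
  proof -
    have "card (edges (induce H (V2 \<inter> S))) \<le> card {e \<in> edges G. e \<subseteq> V2}"
      using fin(2) by (intro card_mono) (auto simp: H induce_def)
    with q show ?thesis by simp
  qed
  moreover have "(V1 \<inter> S) \<union> (V2 \<inter> S) = verts H" "(V1 \<inter> S) \<inter> (V2 \<inter> S) = {}"
    using V S by (auto simp: H induce_def)
  moreover have "?F \<subseteq> edges (complete_graph (V1 \<inter> S))"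
    by (simp add: complete_graph_def)
  ultimately show "H \<in> edge_split_graphs p q"
    using sH unfolding edge_split_graphs_def by blast
qed

end

(* Two partitions of the same vertex set into a nearly complete and a nearly edgeless part differ in
   boundedly many vertices, since the overlap of a nearly complete with a nearly edgeless set is small.
   Let G be minimally not (p,q)-edge-split, and start from a partition of G - v. A partition of G
   always fails on a bounded set T of vertices, so a partition that is valid on a set containing T
   places some vertex of T on the other side. Branching over the vertices of T that may be switched,
   down to a depth exceeding the bound on the number of differences, collects a bounded set of
   vertices whose induced subgraph is not edge-split. By minimality this set is all of G. *)

theory Submission
  imports Defs
begin

section \<open>Splits of a vertex set, given by one side\<close>

text \<open>The side \<open>W\<close> may contain vertices outside \<open>S\<close>, so the same
  \<open>W\<close> restricts to every smaller vertex set without being changed.\<close>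

definition split_by :: "'a set set \<Rightarrow> nat \<Rightarrow> nat \<Rightarrow> 'a set \<Rightarrow> 'a set \<Rightarrow> bool" where
  "split_by E p q S W \<longleftrightarrow> card ([S \<inter> W]\<^bsup>2\<^esup> - E) \<le> p \<and> card ([S - W]\<^bsup>2\<^esup> \<inter> E) \<le> q"

lemma split_by_mono:
  assumes "split_by E p q S W" "T \<subseteq> S" "finite S"
  shows "split_by E p q T W"
proof -
  have "card ([T \<inter> W]\<^bsup>2\<^esup> - E) \<le> card ([S \<inter> W]\<^bsup>2\<^esup> - E)"
    using assms by (intro card_mono finite_Diff finite_imp_finite_nsets Diff_mono nsets_mono) auto
  moreover have "card ([T - W]\<^bsup>2\<^esup> \<inter> E) \<le> card ([S - W]\<^bsup>2\<^esup> \<inter> E)"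
    using assms by (intro card_mono finite_Int disjI1 finite_imp_finite_nsets Int_mono nsets_mono) auto
  ultimately show ?thesis
    using assms(1) by (auto simp: split_by_def)
qed

text \<open>The deleted set \<open>F\<close> is forced to consist of the non-edges within
  \<open>V1\<close>, so its existence amounts to a bound on the number of these non-edges.\<close>

lemma induce_in_edge_split_graphs_iff:
  assumes G: "simple_graph G" and S: "S \<subseteq> verts G"
  shows "induce G S \<in> edge_split_graphs p q \<longleftrightarrow> (\<exists>W. split_by (edges G) p q S W)"
proof
  assume "induce G S \<in> edge_split_graphs p q"
  then obtain V1 V2 F where V: "V1 \<union> V2 = S" "V1 \<inter> V2 = {}"
    and F: "F \<subseteq> [V1]\<^bsup>2\<^esup>" "card F \<le> p" "{e \<in> edges G. e \<subseteq> S \<and> e \<subseteq> V1} = [V1]\<^bsup>2\<^esup> - F"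
    and q: "card {e \<in> edges G. e \<subseteq> S \<and> e \<subseteq> V2} \<le> q"
    by (auto simp: edge_split_graphs_def complete_graph_def delete_edges_def induce_def conj_assoc)
  have sides: "S \<inter> V1 = V1" "S - V1 = V2"
    using V by auto
  have "[V1]\<^bsup>2\<^esup> - edges G = F"
  proof (intro equalityI subsetI)
    fix e assume e: "e \<in> F"
    then have "e \<in> [V1]\<^bsup>2\<^esup>" "e \<subseteq> V1" "e \<notin> [V1]\<^bsup>2\<^esup> - F"
      using F(1) by (auto simp: nsets_def)
    then show "e \<in> [V1]\<^bsup>2\<^esup> - edges G"
      using F(3) V(1) by blast
  qed (use F(3) in blast)
  moreover have "[V2]\<^bsup>2\<^esup> \<inter> edges G = {e \<in> edges G. e \<subseteq> S \<and> e \<subseteq> V2}"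
    using G V by (auto simp: simple_graph_def nsets_def)
  ultimately have "split_by (edges G) p q S V1"
    using F(2) q by (simp add: split_by_def sides)
  then show "\<exists>W. split_by (edges G) p q S W" ..
next
  assume "\<exists>W. split_by (edges G) p q S W"
  then obtain W where W: "split_by (edges G) p q S W" ..
  have "simple_graph (induce G S)"
    using G finite_subset[OF S] by (auto simp: simple_graph_def induce_def nsets_def)
  moreover have "induce (induce G S) (S \<inter> W)
      = delete_edges (complete_graph (S \<inter> W)) ([S \<inter> W]\<^bsup>2\<^esup> - edges G)"
    using G by (auto simp: induce_def delete_edges_def complete_graph_def simple_graph_def nsets_def)
  moreover have "edges (induce (induce G S) (S - W)) = [S - W]\<^bsup>2\<^esup> \<inter> edges G"
    using G by (auto simp: induce_def simple_graph_def nsets_def)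
  moreover have "S \<inter> W \<union> (S - W) = verts (induce G S)" "S \<inter> W \<inter> (S - W) = {}"
    by (auto simp: induce_def)
  moreover have "[S \<inter> W]\<^bsup>2\<^esup> - edges G \<subseteq> edges (complete_graph (S \<inter> W))"
    by (simp add: complete_graph_def)
  ultimately show "induce G S \<in> edge_split_graphs p q"
    using W unfolding edge_split_graphs_def split_by_def mem_Collect_eq
    by (intro conjI exI[of _ "S \<inter> W"] exI[of _ "S - W"] exI[of _ "[S \<inter> W]\<^bsup>2\<^esup> - edges G"]) simp_all
qed

section \<open>Witnesses of failure and branching\<close>

lemma card_Union_nsets_le:
  assumes "F \<subseteq> [A]\<^bsup>k\<^esup>" "finite F"
  shows "card (\<Union>F) \<le> k * card F"
proof -
  have "card (\<Union>F) \<le> (\<Sum>e\<in>F. card e)"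
    using card_UN_le[OF assms(2), of id] by simp
  also have "\<dots> \<le> (\<Sum>e\<in>F. k)"
    using assms(1) by (intro sum_mono) (auto simp: nsets_def)
  finally show ?thesis
    by (simp add: mult.commute)
qed

text \<open>A failing \<open>P\<close> has \<open>p + 1\<close> non-edges inside its side or
  \<open>q + 1\<close> edges outside it, and \<open>T\<close> collects their endpoints. A
  \<open>W\<close> that agreed with \<open>P\<close> on \<open>T\<close> would have all these pairs
  on the same side, hence could not be valid on any superset of \<open>T\<close>.\<close>

lemma not_split_by_witness:
  assumes "\<not> split_by E p q V P"
  obtains T where "T \<subseteq> V" "finite T" "card T \<le> 2 * (p + q + 1)"
    "\<And>S W. T \<subseteq> S \<Longrightarrow> finite S \<Longrightarrow> split_by E p q S W \<Longrightarrow> \<exists>x\<in>T. x \<in> P \<longleftrightarrow> x \<notin> W"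
proof -
  consider "p + 1 \<le> card ([V \<inter> P]\<^bsup>2\<^esup> - E)" | "q + 1 \<le> card ([V - P]\<^bsup>2\<^esup> \<inter> E)"
    using assms by (force simp: split_by_def)
  then show thesis
  proof cases
    case 1
    then obtain F where F: "F \<subseteq> [V \<inter> P]\<^bsup>2\<^esup> - E" "card F = p + 1" "finite F"
      using obtain_subset_with_card_n by metis
    have sub: "\<Union>F \<subseteq> V \<inter> P" and fin: "finite (\<Union>F)"
      using F by (auto simp: nsets_def)
    show thesis
    proof (rule that[of "\<Union>F"])
      show "card (\<Union>F) \<le> 2 * (p + q + 1)"
        using card_Union_nsets_le[OF order.trans[OF F(1) Diff_subset]] F by simp
      fix S W assume S: "\<Union>F \<subseteq> S" "finite S" "split_by E p q S W"
      show "\<exists>x\<in>\<Union>F. x \<in> P \<longleftrightarrow> x \<notin> W"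
      proof (rule ccontr)
        assume "\<not> (\<exists>x\<in>\<Union>F. x \<in> P \<longleftrightarrow> x \<notin> W)"
        then have "\<Union>F \<subseteq> S \<inter> W"
          using sub S(1) by blast
        then have "F \<subseteq> [S \<inter> W]\<^bsup>2\<^esup> - E"
          using F(1) by (auto simp: nsets_def)
        then have "card F \<le> card ([S \<inter> W]\<^bsup>2\<^esup> - E)"
          using S(2) by (intro card_mono finite_Diff finite_imp_finite_nsets) auto
        then show False
          using S(3) F(2) by (simp add: split_by_def)
      qed
    qed (use sub fin in auto)
  next
    case 2
    then obtain F where F: "F \<subseteq> [V - P]\<^bsup>2\<^esup> \<inter> E" "card F = q + 1" "finite F"
      using obtain_subset_with_card_n by metis
    have sub: "\<Union>F \<subseteq> V - P" and fin: "finite (\<Union>F)"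
      using F by (auto simp: nsets_def)
    show thesis
    proof (rule that[of "\<Union>F"])
      show "card (\<Union>F) \<le> 2 * (p + q + 1)"
        using card_Union_nsets_le[OF order.trans[OF F(1) Int_lower1]] F by simp
      fix S W assume S: "\<Union>F \<subseteq> S" "finite S" "split_by E p q S W"
      show "\<exists>x\<in>\<Union>F. x \<in> P \<longleftrightarrow> x \<notin> W"
      proof (rule ccontr)
        assume "\<not> (\<exists>x\<in>\<Union>F. x \<in> P \<longleftrightarrow> x \<notin> W)"
        then have "\<Union>F \<subseteq> S - W"
          using sub S(1) by blast
        then have "F \<subseteq> [S - W]\<^bsup>2\<^esup> \<inter> E"
          using F(1) by (auto simp: nsets_def)
        then have "card F \<le> card ([S - W]\<^bsup>2\<^esup> \<inter> E)"
          using S(2) by (intro card_mono finite_Int disjI1 finite_imp_finite_nsets) auto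
        then show False
          using S(3) F(2) by (simp add: split_by_def)
      qed
    qed (use sub fin in auto)
  qed
qed

text \<open>This is the geometric sum of \<open>t^i\<close> for \<open>i\<close> from 1 to
  \<open>k\<close>: at most \<open>t\<close> witness vertices, and below each of them a set of depth
  one less.\<close>

fun branching_bound :: "nat \<Rightarrow> nat \<Rightarrow> nat" where
  "branching_bound t 0 = 0"
| "branching_bound t (Suc k) = t + t * branching_bound t k"

text \<open>A \<open>W\<close> valid on the collected set disagrees with \<open>P\<close> at some
  witness vertex. Switching that vertex in \<open>P\<close> and applying the induction hypothesis
  yields \<open>k\<close> further disagreements, which is why \<open>P\<close> varies in the
  induction. If \<open>S\<close> has no valid \<open>W\<close> at all, the claim is vacuous; this is
  the case aimed at for large \<open>k\<close>.\<close>

lemma branching: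
  assumes "\<And>P. \<not> split_by E p q V P"
  shows "\<exists>S \<subseteq> V. finite S \<and> card S \<le> branching_bound (2 * (p + q + 1)) k \<and>
    (\<forall>W. split_by E p q S W \<longrightarrow> k \<le> card {x \<in> S. x \<in> P \<longleftrightarrow> x \<notin> W})"
proof (induction k arbitrary: P)
  case 0
  then show ?case by (intro exI[of _ "{}"]) auto
next
  case (Suc k)
  \<comment> \<open>\<open>?P x\<close> is \<open>P\<close> with the vertex \<open>x\<close> moved
    to the other side.\<close>
  let ?t = "2 * (p + q + 1)" and ?P = "\<lambda>x. (P - {x}) \<union> ({x} - P)"
  obtain T where T: "T \<subseteq> V" "finite T" "card T \<le> ?t"
    "\<And>S W. T \<subseteq> S \<Longrightarrow> finite S \<Longrightarrow> split_by E p q S W \<Longrightarrow> \<exists>x\<in>T. x \<in> P \<longleftrightarrow> x \<notin> W"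
    using not_split_by_witness[OF assms] by metis
  have "\<forall>x. \<exists>B \<subseteq> V. finite B \<and> card B \<le> branching_bound ?t k \<and>
      (\<forall>W. split_by E p q B W \<longrightarrow> k \<le> card {y \<in> B. y \<in> ?P x \<longleftrightarrow> y \<notin> W})"
    by (intro allI Suc.IH)
  from choice[OF this] obtain B where
    B: "\<And>x. B x \<subseteq> V" "\<And>x. finite (B x)" "\<And>x. card (B x) \<le> branching_bound ?t k"
      "\<And>x W. split_by E p q (B x) W \<Longrightarrow> k \<le> card {y \<in> B x. y \<in> ?P x \<longleftrightarrow> y \<notin> W}"
    by blast
  define S where "S = T \<union> (\<Union>x\<in>T. B x)"
  have fin: "finite S"
    using T B by (auto simp: S_def)
  have "card S \<le> card T + (\<Sum>x\<in>T. card (B x))"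
    unfolding S_def by (rule order.trans[OF card_Un_le add_left_mono[OF card_UN_le[OF T(2)]]])
  also have "\<dots> \<le> ?t + card T * branching_bound ?t k"
    using T(3) sum_bounded_above[of T "\<lambda>x. card (B x)"] B(3) by (intro add_mono) auto
  also have "\<dots> \<le> branching_bound ?t (Suc k)"
    using T(3) by (simp only: branching_bound.simps add_le_cancel_left mult_le_mono1)
  finally have "card S \<le> branching_bound ?t (Suc k)" .
  moreover have "Suc k \<le> card {x \<in> S. x \<in> P \<longleftrightarrow> x \<notin> W}" if W: "split_by E p q S W" for W
  proof -
    have "T \<subseteq> S"
      by (simp add: S_def)
    from T(4)[OF this fin W] obtain x where x: "x \<in> T" "x \<in> P \<longleftrightarrow> x \<notin> W" ..
    let ?D = "{y \<in> B x. y \<in> ?P x \<longleftrightarrow> y \<notin> W}"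
    have "split_by E p q (B x) W"
      using x(1) by (intro split_by_mono[OF W _ fin]) (auto simp: S_def)
    then have "Suc k \<le> Suc (card ?D)"
      using B(4) by simp
    \<comment> \<open>At \<open>x\<close> itself \<open>W\<close> agrees with the switched
      \<open>?P x\<close>, so \<open>x\<close> is not counted in \<open>?D\<close>. Elsewhere
      \<open>?P x\<close> and \<open>P\<close> coincide.\<close>
    also have "\<dots> = card (insert x ?D)"
      using x B(2) by (subst card_insert_disjoint) auto
    also have "\<dots> \<le> card {y \<in> S. y \<in> P \<longleftrightarrow> y \<notin> W}"
      using x fin by (intro card_mono) (auto simp: S_def)
    finally show ?thesis .
  qed
  moreover have "S \<subseteq> V"
    unfolding S_def by (intro Un_least UN_least T(1) B(1))
  ultimately show ?case
    using fin by blast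
qed

section \<open>Closeness of two splits and the size bound\<close>

lemma card_le_Suc_choose_two: "n \<le> Suc (n choose 2)"
  by (induction n) (auto simp: numeral_2_eq_2)

text \<open>The set \<open>?X\<close> lies on the nearly complete side of \<open>P\<close> and on
  the nearly edgeless side of \<open>W\<close>. Each of its pairs is either one of at most
  \<open>p\<close> non-edges or one of at most \<open>q\<close> edges.\<close>

lemma card_Diff_split_by_le:
  assumes "split_by E p q S P" "split_by E p q S W" "finite S"
  shows "card (S \<inter> P - W) \<le> p + q + 1"
proof -
  let ?X = "S \<inter> P - W"
  have fin: "finite ?X" "finite ([S \<inter> P]\<^bsup>2\<^esup>)" "finite ([S - W]\<^bsup>2\<^esup>)"
    using assms(3) by (auto intro: finite_imp_finite_nsets)
  have "card ?X choose 2 = card ([?X]\<^bsup>2\<^esup>)"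
    by (simp add: card_nsets)
  also have "\<dots> \<le> card (([S \<inter> P]\<^bsup>2\<^esup> - E) \<union> ([S - W]\<^bsup>2\<^esup> \<inter> E))"
    using fin by (intro card_mono) (auto simp: nsets_def)
  also have "\<dots> \<le> card ([S \<inter> P]\<^bsup>2\<^esup> - E) + card ([S - W]\<^bsup>2\<^esup> \<inter> E)"
    by (rule card_Un_le)
  also have "\<dots> \<le> p + q"
    using assms(1,2) by (auto simp: split_by_def)
  finally show ?thesis
    using card_le_Suc_choose_two[of "card ?X"] by simp
qed

lemma card_forbidden_le:
  assumes "G \<in> forbidden_induced_subgraphs (edge_split_graphs p q)"
  shows "card (verts G) \<le> branching_bound (2 * (p + q + 1)) (2 * (p + q + 1) + 2)"
proof (cases "verts G = {}")
  case False
  then obtain v where v: "v \<in> verts G" by blast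
  \<comment> \<open>The depth \<open>?k\<close> exceeds by one the largest possible number of
    differences: \<open>p + q + 1\<close> in each direction, and one more for
    \<open>v\<close>.\<close>
  let ?E = "edges G" and ?k = "2 * (p + q + 1) + 2"
  have G: "simple_graph G" "G \<notin> edge_split_graphs p q"
    and proper: "\<And>S. S \<subset> verts G \<Longrightarrow> induce G S \<in> edge_split_graphs p q"
    using assms by (auto simp: forbidden_induced_subgraphs_def proper_induced_subgraph_def)
  have fin: "finite (verts G)"
    using G by (simp add: simple_graph_def)
  have split: "\<exists>W. split_by ?E p q S W" if "S \<subset> verts G" for S
    using proper[OF that] induce_in_edge_split_graphs_iff[OF G(1)] that by blast
  have "induce G (verts G) = G"
    using G(1) by (cases G) (auto simp: induce_def simple_graph_def nsets_def)
  then have "\<not> split_by ?E p q (verts G) P" for P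
    using induce_in_edge_split_graphs_iff[OF G(1) order.refl, of p q] G(2) by auto
  moreover obtain P where P: "split_by ?E p q (verts G - {v}) P"
    using split[of "verts G - {v}"] v by auto
  ultimately obtain S where S: "S \<subseteq> verts G" "finite S"
      "card S \<le> branching_bound (2 * (p + q + 1)) ?k"
      "\<And>W. split_by ?E p q S W \<Longrightarrow> ?k \<le> card {x \<in> S. x \<in> P \<longleftrightarrow> x \<notin> W}"
    using branching[of ?E p q "verts G" ?k P] by blast
  have "S = verts G"
  proof (rule ccontr)
    assume "S \<noteq> verts G"
    then obtain W where W: "split_by ?E p q S W"
      using split S(1) by blast
    \<comment> \<open>\<open>P\<close> is only known to be valid away from \<open>v\<close>, so the
      two splits are compared on \<open>?S\<close> and \<open>v\<close> is counted
      separately.\<close>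
    let ?S = "S - {v}"
    have PS: "split_by ?E p q ?S P" and WS: "split_by ?E p q ?S W"
      using split_by_mono[OF P, of ?S] split_by_mono[OF W, of ?S] S fin by auto
    have "?k \<le> card {x \<in> S. x \<in> P \<longleftrightarrow> x \<notin> W}"
      by (rule S(4)[OF W])
    also have "\<dots> \<le> card ({v} \<union> ((?S \<inter> P - W) \<union> (?S \<inter> W - P)))"
      using S(2) by (intro card_mono) auto
    also have "\<dots> \<le> 1 + (card (?S \<inter> P - W) + card (?S \<inter> W - P))"
      using card_Un_le[of "{v}" "(?S \<inter> P - W) \<union> (?S \<inter> W - P)"]
        card_Un_le[of "?S \<inter> P - W" "?S \<inter> W - P"] by simp
    also have "\<dots> \<le> 1 + 2 * (p + q + 1)"
      using card_Diff_split_by_le[OF PS WS] card_Diff_split_by_le[OF WS PS] S(2) by simp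
    finally show False by simp
  qed
  with S(3) show ?thesis by simp
qed simp

section \<open>Finitely many isomorphism classes of bounded size\<close>

text \<open>Over an infinite vertex type \<open>A\<close> may be infinite, so graphs are first
  relabelled by initial segments of the naturals. Only finitely many labelled graphs arise, and each
  determines its class.\<close>

lemma finite_quotient_graph_iso:
  assumes A: "\<And>G :: 'a ugraph. G \<in> A \<Longrightarrow> simple_graph G \<and> card (verts G) \<le> N"
  shows "finite (A // graph_iso)"
proof -
  have "\<exists>h. bij_betw h (verts G) {0..<card (verts G)}" if "G \<in> A" for G
    using A[OF that] by (intro ex_bij_betw_finite_nat) (simp add: simple_graph_def)
  then obtain h where h: "\<And>G. G \<in> A \<Longrightarrow> bij_betw (h G) (verts G) {0..<card (verts G)}"
    by metis
  have sub: "e \<subseteq> verts G" if "G \<in> A" "e \<in> edges G" for G e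
    using A that by (auto simp: simple_graph_def nsets_def)
  \<comment> \<open>The numbering \<open>h G\<close> is arbitrary, so isomorphic graphs may have
    different codes. It suffices that equal codes imply isomorphism.\<close>
  define code where "code G = (card (verts G), (`) (h G) ` edges G)" for G
  have "code ` A \<subseteq> {..N} \<times> Pow (Pow {..<N})"
  proof -
    have "h G x < N" if "G \<in> A" "e \<in> edges G" "x \<in> e" for G e x
      using bij_betw_apply[OF h] sub that A[of G] by fastforce
    then show ?thesis
      using A by (fastforce simp: code_def)
  qed
  then have fin: "finite (code ` A)"
    by (rule finite_subset) auto
  have iso: "(G, H) \<in> graph_iso" if GH: "G \<in> A" "H \<in> A" and eq: "code G = code H" for G H
  proof -
    \<comment> \<open>Pass to the common labels by \<open>h G\<close> and return by the inverse of
      \<open>h H\<close>.\<close>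
    let ?f = "inv_into (verts H) (h H) \<circ> h G"
    have bG: "bij_betw (h G) (verts G) {0..<card (verts H)}"
      using h[OF GH(1)] eq by (simp add: code_def)
    have bH: "bij_betw (h H) (verts H) {0..<card (verts H)}"
      by (rule h[OF GH(2)])
    have f: "bij_betw ?f (verts G) (verts H)"
      by (rule bij_betw_trans[OF bG bij_betw_inv_into[OF bH]])
    \<comment> \<open>Taking images under \<open>h K\<close> is injective on subsets of
      \<open>verts K\<close>, so no non-edge acquires the label set of an edge.\<close>
    have edge: "e \<in> edges K \<longleftrightarrow> h K ` e \<in> (`) (h K) ` edges K"
      if "K \<in> A" "e \<subseteq> verts K" for K e
      using inj_on_image_mem_iff[OF inj_on_image_Pow[OF bij_betw_imp_inj_on[OF h[OF that(1)]]]]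
        sub[OF that(1)] that(2) by (simp add: subset_iff)
    have "{u, v} \<in> edges G \<longleftrightarrow> {?f u, ?f v} \<in> edges H"
      if uv: "u \<in> verts G" "v \<in> verts G" for u v
    proof -
      have "h H (?f w) = h G w" if "w \<in> verts G" for w
        using bij_betw_inv_into_right[OF bH] bij_betw_apply[OF bG that] by simp
      then have "h H ` {?f u, ?f v} = h G ` {u, v}"
        using uv by simp
      then show ?thesis
        using edge[OF GH(1), of "{u, v}"] edge[OF GH(2), of "{?f u, ?f v}"] eq uv
          bij_betw_apply[OF f] by (simp add: code_def)
    qed
    then show ?thesis
      using f A GH by (auto simp: graph_iso_def intro!: exI[of _ ?f])
  qed
  \<comment> \<open>Every class is recovered from the code of a member through a chosen graph with
    that code, so there are at most as many classes as codes.\<close>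
  have "A // graph_iso \<subseteq> (\<lambda>c. graph_iso `` {inv_into A code c}) ` code ` A"
  proof
    fix X assume "X \<in> A // graph_iso"
    then obtain G where G: "G \<in> A" "X = graph_iso `` {G}"
      by (rule quotientE)
    have "(G, inv_into A code (code G)) \<in> graph_iso"
      using G(1) by (intro iso) (auto simp: inv_into_into f_inv_into_f)
    then have "X = graph_iso `` {inv_into A code (code G)}"
      using equiv_class_eq[OF equiv_graph_iso] G(2) by blast
    then show "X \<in> (\<lambda>c. graph_iso `` {inv_into A code c}) ` code ` A"
      using G(1) by blast
  qed
  then show ?thesis
    by (rule finite_subset) (intro finite_imageI fin)
qed

theorem theorem1p8:
  fixes p q :: nat
  shows "finite (forbidden_induced_subgraphs (edge_split_graphs p q :: 'a ugraph set) // graph_iso)"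
proof (rule finite_quotient_graph_iso)
  fix G :: "'a ugraph"
  assume "G \<in> forbidden_induced_subgraphs (edge_split_graphs p q)"
  then show "simple_graph G \<and>
      card (verts G) \<le> branching_bound (2 * (p + q + 1)) (2 * (p + q + 1) + 2)"
    using card_forbidden_le[of G p q] by (simp add: forbidden_induced_subgraphs_def)
qed

end
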